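(* Let $0<\gamma<1$ and $n>-1$ (with $n$ real). Then, for all $x>0$, $$\int_0^x \mathrm{e}^{-\gamma t}t^\nu I_{\nu+n}(t)\,\mathrm{d}t>\mathrm{e}^{-\gamma x}x^\nu I_{\nu+n+1}(x), \quad\nu>-\tfrac{1}{2}(n+1),\qquad (1)$$ $$\int_0^x t^\nu I_{\nu+n}(t)\,\mathrm{d}t<\frac{x^\nu}{2\nu+n+1}\Big(2(\nu+n+1)I_{\nu+n+1}(x)-(n+1)I_{\nu+n+3}(x)\Big)\qquad (2)$$ $$\phantom{\int_0^x t^\nu I_{\nu+n}(t)\,\mathrm{d}t}<\frac{2(\nu+n+1)}{2\nu+n+1}x^\nu I_{\nu+n+1}(x), \quad \nu>-\tfrac{1}{2}(n+1),\qquad (3)$$ $$\int_0^x \mathrm{e}^{-\gamma t}t^{\nu}I_\nu(t)\,\mathrm{d}t<\frac{\mathrm{e}^{-\gamma x}x^\nu}{(2\nu+1)(1-\gamma)}\Big(2(\nu+1)I_{\nu+1}(x)-I_{\nu+3}(x)\Big), \quad \nu\geq\tfrac{1}{2},\qquad (4)$$ $$\int_0^x \mathrm{e}^{-\gamma t}t^{\nu+1} I_{\nu}(t)\,\mathrm{d}t>\mathrm{e}^{-\gamma x}x^{\nu+1} I_{\nu+1}(x), \quad \nu>-1,\qquad (5)$$ $$\int_0^x \mathrm{e}^{-\gamma t}t^{\nu+1} I_{\nu}(t)\,\mathrm{d}t<\frac{1}{1-\gamma}\mathrm{e}^{-\gamma x}x^{\nu+1} I_{\nu+1}(x), \quad\nu>-\tfrac{1}{2}.\qquad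 (6)$$ Here (2) and (3) form a chain, both holding for $\nu>-\frac12(n+1)$: the integral is less than the right-hand side of (2), which is less than the right-hand side of (3). The constants $\frac{2(\nu+n+1)}{2\nu+n+1}$ (as a constant in the bound (3) for $\int_0^x t^\nu I_{\nu+n}(t)\,\mathrm{d}t$), $1$ in (5), and $\frac{1}{1-\gamma}$ in (6) cannot be improved: for fixed parameters, the constant in the upper bounds (3) and (6) cannot be replaced by a smaller constant independent of $x$, and the constant $1$ in the lower bound (5) cannot be replaced by a larger constant independent of $x$. Moreover, inequalities (1) and (5) hold for all $\gamma>0$.
   Context: $I_\nu$ denotes the modified Bessel function of the first kind of real order $\nu$, considered for positive real argument. *)

theory Defs
  imports "HOL-Analysis.Analysis"
begin

text \<open>
  The modified Bessel function of the first kind \<open>I\<^sub>\<nu>(x)\<close> of real order \<open>\<nu>\<close>, for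
  positive real argument \<open>x\<close>, by its series
  \<open>\<Sum>k. (x/2)\<^bsup>\<nu>+2k\<^esup> / (k! \<Gamma>(\<nu>+k+1))\<close>.  The entire function \<^const>\<open>rGamma\<close>
  (the reciprocal of \<open>\<Gamma>\<close>) makes the terms vanish where \<open>\<Gamma>(\<nu>+k+1)\<close> has a pole, as is
  usual for negative integer orders.  Values at \<open>x \<le> 0\<close> carry no meaning.
\<close>
definition bessel_I :: "real \<Rightarrow> real \<Rightarrow> real" where
  "bessel_I \<nu> x = (\<Sum>k. (x / 2) powr (\<nu> + 2 * real k) * rGamma (\<nu> + real k + 1) / fact k)"

end

theory Submission
  imports Defs
begin

text \<open>
  Every integral inequality here compares \<open>F x = \<integral>\<^sub>0\<^sup>x f\<close> with an explicit bound \<open>g x\<close>. Both sides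
  vanish at \<open>0\<close>, so it suffices to compare \<open>f\<close> with \<open>g'\<close> on the open interval
  (\<open>less_integral_by_derivative\<close> and its mirror image). The integrands may be unbounded near \<open>0\<close>,
  so the comparison asks only for integrability and for continuity where \<open>t > 0\<close>.
  All the bounds are built from functions
  \<open>exp (-\<gamma> t) t\<^sup>a I\<^sub>\<mu>(t)\<close>, and the derivative of such a function is again a combination of such
  functions (\<open>weighted_bessel_deriv\<close>), by \<open>(t\<^sup>\<mu> I\<^sub>\<mu>)' = t\<^sup>\<mu> I\<^bsub>\<mu>-1\<^esub>\<close>. After differentiation each claim
  reduces to one of three facts about orders above \<open>-1\<close>: positivity of \<open>I\<^sub>\<mu>\<close>, the recurrence
  \<open>I\<^sub>\<mu> - I\<^bsub>\<mu>+2\<^esub> = (2(\<mu>+1)/t) I\<^bsub>\<mu>+1\<^esub>\<close>, and Soni's inequality \<open>I\<^bsub>\<nu>+1\<^esub> < I\<^sub>\<nu>\<close> for \<open>\<nu> \<ge> -1/2\<close>.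

  The lower bounds follow because differentiating \<open>exp (-\<gamma> t) t\<^sup>a I\<^bsub>\<mu>+1\<^esub>\<close> yields the integrand minus
  a positive term. In the undamped upper bound, the recurrence removes the order \<open>\<mu>+1\<close> from the
  derivative and leaves the integrand plus a positive multiple of \<open>I\<^bsub>\<mu>+3\<^esub>\<close>. In the damped upper
  bounds the derivative of \<open>exp (-\<gamma> t)\<close> costs \<open>\<gamma>\<close> times \<open>t\<^bsup>\<nu>+1\<^esup> I\<^bsub>\<nu>+1\<^esub>\<close> or times \<open>\<integral>\<^sub>0\<^sup>t u\<^sup>\<nu> I\<^sub>\<nu>(u) du\<close>; Soni's
  inequality bounds this loss by \<open>\<gamma>\<close> times the undamped integrand, \<open>t\<^bsup>\<nu>+1\<^esup> I\<^sub>\<nu>\<close> or \<open>t\<^sup>\<nu> I\<^sub>\<nu>\<close>, which is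
  where the factor \<open>1/(1-\<gamma>)\<close> comes from.

  The optimal constants are read off from limits. The constants
  \<open>2(\<nu>+n+1)/(2\<nu>+n+1)\<close> and \<open>1\<close> are attained in the limit \<open>x \<rightarrow> 0\<close>, where the leading power of
  \<open>I\<^sub>\<mu>\<close> decides. The constant \<open>1/(1-\<gamma>)\<close> is attained as \<open>x \<rightarrow> \<infinity>\<close>: there \<open>I\<^bsub>\<nu>+1\<^esub>/I\<^sub>\<nu> \<rightarrow> 1\<close>, so
  Soni's inequality loses nothing asymptotically, and the bound itself grows exponentially, which
  makes the contribution of any initial interval negligible.
\<close>

section \<open>The Bessel--Clifford function\<close>

text \<open>
  The entire factor of the Bessel function: \<open>I\<^sub>\<mu>(t) = (t/2)\<^sup>\<mu> C\<^sub>\<mu>(t\<^sup>2/4)\<close>. Separating it from the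
  power \<open>(t/2)\<^sup>\<mu>\<close> turns questions about \<open>I\<^sub>\<mu>\<close> near \<open>0\<close> into continuity of \<open>C\<^sub>\<mu>\<close>.
\<close>

definition bessel_clifford :: "real \<Rightarrow> real \<Rightarrow> real" where
  "bessel_clifford \<mu> y = (\<Sum>k. rGamma (\<mu> + real k + 1) / fact k * y ^ k)"

lemma bessel_clifford_coeff_pos:
  fixes \<mu> :: real
  assumes "\<mu> > -1"
  shows "rGamma (\<mu> + real k + 1) / fact k > 0"
  using assms by (simp add: rGamma_inverse_Gamma Gamma_real_pos)

text \<open>
  By \<open>rGamma z = z * rGamma (z + 1)\<close>, consecutive terms have ratio \<open>y / ((\<mu>+k+1)(k+1))\<close>.
\<close>
lemma bessel_clifford_summable:
  assumes "\<mu> > -1"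
  shows "summable (\<lambda>k. rGamma (\<mu> + real k + 1) / fact k * y ^ k)"
proof -
  \<comment> \<open>From here on \<open>k + 1 \<ge> 2\<bar>y\<bar>\<close> and \<open>\<mu> + k + 1 \<ge> 1\<close>, so the ratio is at most \<open>1/2\<close> in absolute value.\<close>
  define N where "N = nat \<lceil>2 * \<bar>y\<bar> + 2\<rceil>"
  have step: "norm (rGamma (\<mu> + real (Suc k) + 1) / fact (Suc k) * y ^ Suc k)
      \<le> 1/2 * norm (rGamma (\<mu> + real k + 1) / fact k * y ^ k)" if "k \<ge> N" for k
  proof -
    have k: "real k \<ge> 2 * \<bar>y\<bar> + 2" using that unfolding N_def by linarith
    define r where "r = rGamma (\<mu> + real k + 2)"
    have r0: "r \<ge> 0"
      using assms k by (simp add: r_def rGamma_inverse_Gamma)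
    have rec: "rGamma (\<mu> + real k + 1) = (\<mu> + real k + 1) * r"
      using rGamma_plus1[of "\<mu> + real k + 1"] by (simp add: r_def algebra_simps)
    have "2 * \<bar>y\<bar> * 1 \<le> (real k + 1) * (\<mu> + real k + 1)"
      using k assms by (intro mult_mono) auto
    hence "r * \<bar>y\<bar> ^ k * (2 * \<bar>y\<bar>) \<le> r * \<bar>y\<bar> ^ k * ((real k + 1) * (\<mu> + real k + 1))"
      using r0 by (intro mult_left_mono) auto
    hence "r * \<bar>y\<bar> ^ k * (2 * \<bar>y\<bar>) / (2 * (real k + 1) * fact k)
        \<le> r * \<bar>y\<bar> ^ k * ((real k + 1) * (\<mu> + real k + 1)) / (2 * (real k + 1) * fact k)"
      by (intro divide_right_mono) auto
    also have "r * \<bar>y\<bar> ^ k * ((real k + 1) * (\<mu> + real k + 1)) / (2 * (real k + 1) * fact k)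
        = 1/2 * norm (rGamma (\<mu> + real k + 1) / fact k * y ^ k)"
    proof -
      have cancel: "r * Y * (q * B) / (2 * q * F) = B * r * Y / (2 * F)" if "q \<noteq> 0"
        for Y q B F :: real
        using that by simp
      have "real k + 1 \<noteq> 0" by linarith
      from cancel[OF this] show ?thesis
        using r0 k assms by (simp add: rec abs_mult power_abs)
    qed
    also have "r * \<bar>y\<bar> ^ k * (2 * \<bar>y\<bar>) / (2 * (real k + 1) * fact k)
        = norm (rGamma (\<mu> + real (Suc k) + 1) / fact (Suc k) * y ^ Suc k)"
    proof -
      have cancel: "r * Y * (2 * b) / (2 * q * F) = r / (q * F) * (b * Y)" for Y q b F :: real
        by simp
      have "\<mu> + real (Suc k) + 1 = \<mu> + real k + 2" by simp
      thus ?thesis unfolding cancel using r0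
        by (simp only: r_def[symmetric] fact_Suc) (simp add: abs_mult power_abs mult_ac add_ac)
    qed
    finally show ?thesis .
  qed
  show ?thesis by (rule summable_ratio_test[of "1/2" N]) (use step in auto)
qed

lemma bessel_clifford_deriv:
  assumes "\<mu> > -1"
  shows "(bessel_clifford \<mu> has_real_derivative bessel_clifford (\<mu> + 1) y) (at y)"
proof -
  have "((\<lambda>y. \<Sum>k. rGamma (\<mu> + real k + 1) / fact k * y ^ k) has_real_derivative
      (\<Sum>k. diffs (\<lambda>k. rGamma (\<mu> + real k + 1) / fact k) k * y ^ k)) (at y)"
    by (rule termdiffs_strong_converges_everywhere) (rule bessel_clifford_summable[OF assms])
  moreover have "diffs (\<lambda>k. rGamma (\<mu> + real k + 1) / fact k) k
      = rGamma (\<mu> + 1 + real k + 1) / fact k" for k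
    by (simp add: diffs_def add_ac del: of_nat_Suc)
       (simp add: add_ac)
  ultimately show ?thesis
    by (simp add: bessel_clifford_def[abs_def])
qed

lemmas bessel_clifford_deriv_chain [derivative_intros] =
  DERIV_chain2[OF bessel_clifford_deriv]

lemma continuous_on_bessel_clifford [continuous_intros]:
  assumes "\<mu> > -1" "continuous_on S f"
  shows "continuous_on S (\<lambda>t. bessel_clifford \<mu> (f t))"
proof -
  have "continuous_on UNIV (bessel_clifford \<mu>)"
    by (meson DERIV_continuous_on assms(1) bessel_clifford_deriv has_field_derivative_at_within)
  from continuous_on_compose2[OF this assms(2)] show ?thesis by simp
qed

text \<open>
  Coefficientwise this is \<open>rGamma (\<mu>+k+1) = ((\<mu>+1) + k) * rGamma (\<mu>+k+2)\<close>: the summand \<open>\<mu>+1\<close> gives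
  \<open>(\<mu>+1) C\<^bsub>\<mu>+1\<^esub>\<close>, and the summand \<open>k\<close> cancels against \<open>k!\<close>, which shifts the series by one and
  gives \<open>y C\<^bsub>\<mu>+2\<^esub>\<close>.
\<close>
lemma bessel_clifford_recurrence:
  assumes "\<mu> > -1"
  shows "bessel_clifford \<mu> y
    = (\<mu> + 1) * bessel_clifford (\<mu> + 1) y + y * bessel_clifford (\<mu> + 2) y"
proof -
  let ?c = "\<lambda>\<mu> k. rGamma (\<mu> + real k + 1) / fact k * y ^ k"
  let ?d = "\<lambda>k. real k * ?c (\<mu> + 1) k"
  have shift: "?d (Suc k) = y * ?c (\<mu> + 2) k" for k
    by (simp add: add_ac)
  have d: "?d sums (y * bessel_clifford (\<mu> + 2) y)"
  proof -
    have "(\<lambda>k. y * ?c (\<mu> + 2) k) sums (y * bessel_clifford (\<mu> + 2) y)"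
      unfolding bessel_clifford_def
      using bessel_clifford_summable[of "\<mu> + 2" y] assms
      by (intro sums_mult summable_sums) auto
    hence "(\<lambda>k. ?d (Suc k)) sums (y * bessel_clifford (\<mu> + 2) y)"
      by (simp only: shift)
    from sums_Suc[OF this] show ?thesis by simp
  qed
  have "(\<lambda>k. (\<mu> + 1) * ?c (\<mu> + 1) k) sums ((\<mu> + 1) * bessel_clifford (\<mu> + 1) y)"
    unfolding bessel_clifford_def
    using bessel_clifford_summable[of "\<mu> + 1" y] assms
    by (intro sums_mult summable_sums) auto
  from sums_add[OF this d] have "(\<lambda>k. (\<mu> + 1) * ?c (\<mu> + 1) k + ?d k) sums
      ((\<mu> + 1) * bessel_clifford (\<mu> + 1) y + y * bessel_clifford (\<mu> + 2) y)" .
  moreover have "(\<mu> + 1) * ?c (\<mu> + 1) k + ?d k = ?c \<mu> k" for k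
  proof -
    have "rGamma (\<mu> + real k + 1) = (\<mu> + real k + 1) * rGamma (\<mu> + 1 + real k + 1)"
      using rGamma_plus1[of "\<mu> + real k + 1"] by (simp add: add_ac)
    thus ?thesis by (simp only: ring_distribs add_divide_distrib) (simp add: algebra_simps)
  qed
  ultimately show ?thesis
    unfolding bessel_clifford_def[of \<mu>] by (simp add: sums_iff)
qed

lemma bessel_clifford_0: "bessel_clifford \<mu> 0 = rGamma (\<mu> + 1)"
  unfolding bessel_clifford_def by (subst powser_zero) simp

lemma bessel_clifford_gt_value_at_0:
  assumes "\<mu> > -1" "y > 0"
  shows "rGamma (\<mu> + 1) < bessel_clifford \<mu> y"
proof -
  have "sum (\<lambda>k. rGamma (\<mu> + real k + 1) / fact k * y ^ k) {..<1} < bessel_clifford \<mu> y"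
    unfolding bessel_clifford_def
    using assms bessel_clifford_coeff_pos[of \<mu>]
    by (intro sum_less_suminf bessel_clifford_summable mult_pos_pos) auto
  thus ?thesis by simp
qed

lemma bessel_clifford_pos:
  assumes "\<mu> > -1" "y \<ge> 0"
  shows "0 < bessel_clifford \<mu> y"
proof -
  have "rGamma (\<mu> + 1) > 0" using bessel_clifford_coeff_pos[of \<mu> 0] assms by simp
  thus ?thesis
    using assms bessel_clifford_gt_value_at_0[of \<mu> y]
    by (cases "y = 0") (auto simp: bessel_clifford_0)
qed

section \<open>The modified Bessel function\<close>

lemma bessel_I_eq_clifford:
  assumes "\<mu> > -1" "t \<ge> 0"
  shows "bessel_I \<mu> t = (t / 2) powr \<mu> * bessel_clifford \<mu> (t^2 / 4)"
proof -
  have "(t / 2) powr (\<mu> + 2 * real k) = (t / 2) powr \<mu> * (t^2 / 4) ^ k" for k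
  proof (cases "t = 0")
    case False
    hence "(t / 2) powr (2 * real k) = (t^2 / 4) ^ k"
      using assms powr_realpow[of "t / 2" "2 * k"] by (simp add: power_mult power_divide)
    thus ?thesis by (simp add: powr_add)
  qed auto
  hence "bessel_I \<mu> t = (\<Sum>k. (t / 2) powr \<mu> *
      (rGamma (\<mu> + real k + 1) / fact k * (t^2 / 4) ^ k))"
    unfolding bessel_I_def by (simp add: mult_ac)
  also have "\<dots> = (t / 2) powr \<mu> * bessel_clifford \<mu> (t^2 / 4)"
    unfolding bessel_clifford_def by (rule suminf_mult[OF bessel_clifford_summable[OF assms(1)]])
  finally show ?thesis .
qed

lemma bessel_I_pos:
  assumes "\<mu> > -1" "t > 0"
  shows "bessel_I \<mu> t > 0"
  using assms bessel_clifford_pos[of \<mu> "t^2 / 4"] by (simp add: bessel_I_eq_clifford)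

lemma bessel_I_recurrence:
  assumes "\<mu> > -1" "t > 0"
  shows "bessel_I \<mu> t - bessel_I (\<mu> + 2) t = 2 * (\<mu> + 1) / t * bessel_I (\<mu> + 1) t"
proof -
  let ?p = "(t / 2) powr \<mu>" and ?C = "\<lambda>i. bessel_clifford (\<mu> + i) (t^2 / 4)"
  have I: "bessel_I \<mu> t = ?p * ((\<mu> + 1) * ?C 1 + t^2 / 4 * ?C 2)"
    "bessel_I (\<mu> + 1) t = ?p * (t / 2) * ?C 1"
    "bessel_I (\<mu> + 2) t = ?p * (t^2 / 4) * ?C 2"
    using assms bessel_clifford_recurrence[of \<mu> "t^2 / 4"]
    by (simp_all add: bessel_I_eq_clifford powr_add power_divide)
  show ?thesis unfolding I using assms by (simp add: field_simps power2_eq_square)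
qed

text \<open>
  Soni's inequality. With \<open>C\<^sub>\<nu>\<close> taken at \<open>x\<^sup>2/4\<close>, the function
  \<open>S = exp x (C\<^sub>\<nu> - (x/2) C\<^bsub>\<nu>+1\<^esub>)\<close> is a positive multiple of \<open>I\<^sub>\<nu> - I\<^bsub>\<nu>+1\<^esub>\<close> for \<open>x > 0\<close>. The factor \<open>exp x\<close> makes
  the cross terms of its derivative cancel, and the recurrence collapses the rest to
  \<open>S' = exp x (\<nu> + 1/2) C\<^bsub>\<nu>+1\<^esub> \<ge> 0\<close>. Since \<open>S 0 = rGamma (\<nu>+1) > 0\<close>, strictness holds even for
  \<open>\<nu> = -1/2\<close>, where \<open>S\<close> is constant.
\<close>
lemma bessel_I_decreasing_in_order:
  assumes "\<nu> \<ge> -1/2" "x > 0"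
  shows "bessel_I (\<nu> + 1) x < bessel_I \<nu> x"
proof -
  let ?S = "\<lambda>x. exp x * (bessel_clifford \<nu> (x^2/4) - x / 2 * bessel_clifford (\<nu> + 1) (x^2/4))"
  have "?S 0 \<le> ?S x"
  proof (rule DERIV_nonneg_imp_nondecreasing[where f = ?S and a = 0 and b = x])
    fix t :: real assume t: "0 \<le> t"
    have "(?S has_real_derivative exp t * ((\<nu> + 1/2) * bessel_clifford (\<nu> + 1) (t^2/4))) (at t)"
      using assms(1) bessel_clifford_recurrence[of \<nu> "t^2 / 4"]
      by (auto intro!: derivative_eq_intros simp: field_simps power2_eq_square)
    moreover have "0 \<le> exp t * ((\<nu> + 1/2) * bessel_clifford (\<nu> + 1) (t^2/4))"
      using assms bessel_clifford_pos[of "\<nu> + 1" "t^2/4"] by simp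
    ultimately show "\<exists>y. (?S has_real_derivative y) (at t) \<and> 0 \<le> y" by blast
  qed (use assms in auto)
  moreover have "?S 0 > 0"
    using assms bessel_clifford_pos[of \<nu> 0] by simp
  ultimately have "?S x > 0" by linarith
  hence "(x / 2) powr \<nu> * (x / 2 * bessel_clifford (\<nu> + 1) (x^2/4))
      < (x / 2) powr \<nu> * bessel_clifford \<nu> (x^2/4)"
    using assms by (simp add: zero_less_mult_iff)
  moreover have "bessel_I \<nu> x = (x / 2) powr \<nu> * bessel_clifford \<nu> (x^2/4)"
    and "bessel_I (\<nu> + 1) x = (x / 2) powr \<nu> * (x / 2 * bessel_clifford (\<nu> + 1) (x^2/4))"
    using assms by (simp_all add: bessel_I_eq_clifford powr_add)
  ultimately show ?thesis by simp
qed

section \<open>Weighted Bessel functions\<close>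

text \<open>
  All integrands have this shape, and all bounds are linear combinations of such functions; the undamped ones are the case \<open>\<gamma> = 0\<close>.
\<close>
definition weighted_bessel :: "real \<Rightarrow> real \<Rightarrow> real \<Rightarrow> real \<Rightarrow> real" where
  "weighted_bessel \<gamma> a \<mu> t = exp (- \<gamma> * t) * t powr a * bessel_I \<mu> t"

lemma weighted_bessel_0 [simp]: "weighted_bessel \<gamma> a \<mu> 0 = 0"
  by (simp add: weighted_bessel_def)

lemma weighted_bessel_pos:
  assumes "\<mu> > -1" "t > 0"
  shows "weighted_bessel \<gamma> a \<mu> t > 0"
  using assms bessel_I_pos by (simp add: weighted_bessel_def)

lemma weighted_bessel_damping:
  "weighted_bessel \<gamma> a \<mu> t = exp (- \<gamma> * t) * weighted_bessel 0 a \<mu> t"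
  by (simp add: weighted_bessel_def)

text \<open>
  The behaviour at \<open>0\<close> is that of \<open>t powr (a + \<mu>)\<close> times a continuous function: integrable if
  \<open>a + \<mu> > -1\<close>, continuous and vanishing at \<open>0\<close> if \<open>a + \<mu> > 0\<close>. The equation extends to \<open>t = 0\<close>
  because \<open>0 powr r = 0\<close> for every exponent.
\<close>
lemma weighted_bessel_eq_clifford:
  assumes "\<mu> > -1" "t \<ge> 0"
  shows "weighted_bessel \<gamma> a \<mu> t
    = 2 powr (-\<mu>) * exp (- \<gamma> * t) * bessel_clifford \<mu> (t^2 / 4) * t powr (a + \<mu>)"
  using assms
  by (simp add: weighted_bessel_def bessel_I_eq_clifford powr_divide powr_minus powr_add
      field_simps)

lemma continuous_on_weighted_bessel:
  assumes "\<mu> > -1" "S \<subseteq> {0..}" "0 \<notin> S \<or> a + \<mu> > 0"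
  shows "continuous_on S (weighted_bessel \<gamma> a \<mu>)"
proof -
  have "continuous_on S (\<lambda>t. 2 powr (-\<mu>) * exp (- \<gamma> * t) *
      bessel_clifford \<mu> (t^2 / 4) * t powr (a + \<mu>))"
    using assms by (intro continuous_intros continuous_on_powr') auto
  thus ?thesis
    using assms by (subst continuous_on_cong[OF refl weighted_bessel_eq_clifford]) auto
qed

lemma integrable_weighted_bessel:
  assumes "\<mu> > -1" "a + \<mu> > -1" "x \<ge> 0"
  shows "weighted_bessel \<gamma> a \<mu> integrable_on {0..x}"
proof -
  let ?f = "\<lambda>t. 2 powr (-\<mu>) * exp (- \<gamma> * t) * bessel_clifford \<mu> (t^2 / 4)"
  have cont: "continuous_on {0..x} ?f"
    using assms by (intro continuous_intros) auto
  have "(\<lambda>t. ?f t * t powr (a + \<mu>)) absolutely_integrable_on {0..x}"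
  proof (rule absolutely_integrable_bounded_measurable_product_real)
    show "?f \<in> borel_measurable (lebesgue_on {0..x})"
      using cont by (rule continuous_imp_measurable_on_sets_lebesgue) auto
    show "bounded (?f ` {0..x})"
      using cont by (intro compact_imp_bounded compact_continuous_image) auto
    show "(\<lambda>t. t powr (a + \<mu>)) absolutely_integrable_on {0..x}"
      using assms by (intro nonnegative_absolutely_integrable_1 integrable_on_powr_from_0) auto
  qed auto
  hence "(\<lambda>t. ?f t * t powr (a + \<mu>)) integrable_on {0..x}"
    by (rule set_lebesgue_integral_eq_integral)
  thus ?thesis
    using assms weighted_bessel_eq_clifford[of \<mu> _ \<gamma> a]
    by (subst integrable_cong[of _ _ "\<lambda>t. ?f t * t powr (a + \<mu>)"]) auto
qed

lemma weighted_bessel_deriv: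
  assumes "\<mu> > -1" "t > 0"
  shows "(weighted_bessel \<gamma> a (\<mu> + 1) has_real_derivative
      weighted_bessel \<gamma> a \<mu> t - ((\<mu> + 1 - a) / t + \<gamma>) * weighted_bessel \<gamma> a (\<mu> + 1) t) (at t)"
proof -
  let ?g = "\<lambda>t. 2 powr (-(\<mu> + 1)) * exp (- \<gamma> * t) * bessel_clifford (\<mu> + 1) (t^2 / 4)
      * t powr (a + (\<mu> + 1))"
  let ?C = "\<lambda>i. bessel_clifford (\<mu> + i) (t^2 / 4)"
  let ?D = "2 powr (-(\<mu> + 1)) * exp (- \<gamma> * t) * t powr (a + \<mu>) *
      (t^2 / 2 * ?C 2 + (a + \<mu> + 1 - \<gamma> * t) * ?C 1)"
  have "(?g has_real_derivative ?D) (at t)"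
  proof (rule DERIV_cong[OF DERIV_mult])
    show "((\<lambda>t. t powr (a + (\<mu> + 1))) has_real_derivative (a + \<mu> + 1) * t powr (a + \<mu>)) (at t)"
      using has_real_derivative_powr[OF assms(2), of "a + (\<mu> + 1)"] by (simp add: add_ac)
    show "((\<lambda>t. 2 powr (-(\<mu> + 1)) * exp (- \<gamma> * t) * bessel_clifford (\<mu> + 1) (t^2 / 4))
        has_real_derivative 2 powr (-(\<mu> + 1)) * exp (- \<gamma> * t) * (t / 2 * ?C 2 - \<gamma> * ?C 1)) (at t)"
      using assms
      by (auto intro!: derivative_eq_intros simp: add_ac) (simp add: algebra_simps)
    have "t powr (a + (\<mu> + 1)) = t powr (a + \<mu>) * t"
      using assms by (simp add: powr_add)
    thus "2 powr (-(\<mu> + 1)) * exp (- \<gamma> * t) * (t / 2 * ?C 2 - \<gamma> * ?C 1) * t powr (a + (\<mu> + 1))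
        + (a + \<mu> + 1) * t powr (a + \<mu>)
          * (2 powr (-(\<mu> + 1)) * exp (- \<gamma> * t) * ?C 1) = ?D"
      by (simp add: algebra_simps power2_eq_square)
  qed
  moreover have "\<forall>\<^sub>F s in nhds t. weighted_bessel \<gamma> a (\<mu> + 1) s = ?g s"
    using eventually_nhds_in_open[of "{0<..}" t] assms
    by (auto elim!: eventually_mono simp: weighted_bessel_eq_clifford)
  ultimately have "(weighted_bessel \<gamma> a (\<mu> + 1) has_real_derivative ?D) (at t)"
    using DERIV_cong_ev[of t t "weighted_bessel \<gamma> a (\<mu> + 1)" ?g ?D ?D] by simp
  moreover have "?D = weighted_bessel \<gamma> a \<mu> t
      - ((\<mu> + 1 - a) / t + \<gamma>) * weighted_bessel \<gamma> a (\<mu> + 1) t"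
  proof -
    have p: "2 powr (-\<mu>) = 2 * 2 powr (-(\<mu> + 1))" "t powr (a + (\<mu> + 1)) = t powr (a + \<mu>) * t"
      using assms by (simp_all add: powr_add powr_diff)
    have c: "bessel_clifford \<mu> (t^2 / 4) = (\<mu> + 1) * ?C 1 + t^2 / 4 * ?C 2"
      by (rule bessel_clifford_recurrence[OF assms(1)])
    have w: "weighted_bessel \<gamma> a \<mu> t = 2 * 2 powr (-(\<mu> + 1)) * exp (- \<gamma> * t) *
        ((\<mu> + 1) * ?C 1 + t^2 / 4 * ?C 2) * t powr (a + \<mu>)"
      "weighted_bessel \<gamma> a (\<mu> + 1) t = 2 powr (-(\<mu> + 1)) * exp (- \<gamma> * t) * ?C 1 *
        (t powr (a + \<mu>) * t)"
      using assms by (simp_all only: weighted_bessel_eq_clifford p c)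
    show ?thesis unfolding w using assms by (simp add: field_simps power2_eq_square)
  qed
  ultimately show ?thesis by simp
qed

lemma weighted_bessel_recurrence:
  assumes "\<mu> > -1" "t > 0"
  shows "weighted_bessel \<gamma> a \<mu> t - weighted_bessel \<gamma> a (\<mu> + 2) t
    = 2 * (\<mu> + 1) / t * weighted_bessel \<gamma> a (\<mu> + 1) t"
  using bessel_I_recurrence[OF assms]
  by (simp add: weighted_bessel_def right_diff_distrib[symmetric])

lemma weighted_bessel_decreasing_in_order:
  assumes "\<nu> \<ge> -1/2" "x > 0"
  shows "weighted_bessel \<gamma> a (\<nu> + 1) x < weighted_bessel \<gamma> a \<nu> x"
  using bessel_I_decreasing_in_order[OF assms] assms by (simp add: weighted_bessel_def)
section \<open>Comparing integrals through derivatives\<close>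

text \<open>
  The fundamental theorem of calculus for an integrand that is continuous only away from \<open>0\<close>.
\<close>
lemma integral_from_0_has_derivative:
  fixes f :: "real \<Rightarrow> real"
  assumes "f integrable_on {0..x}" "continuous_on {0<..} f" "0 < t" "t < x"
  shows "((\<lambda>u. integral {0..u} f) has_real_derivative f t) (at t)"
proof -
  have "continuous (at t within {0..x}) f"
    using assms(2,3) by (simp add: continuous_at_imp_continuous_at_within continuous_on_eq_continuous_at)
  hence "((\<lambda>u. integral {0..u} f) has_vector_derivative f t) (at t within {0..x})"
    using integral_has_vector_derivative_continuous_at[OF assms(1), of t "{}"] assms by simp
  thus ?thesis
    using assms by (simp add: has_real_derivative_iff_has_vector_derivative at_within_Icc_at)
qed

text \<open>
  The difference \<open>\<integral>\<^sub>0\<^sup>u f - g u\<close> is continuous on the closed interval, vanishes at \<open>0\<close> and has a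
  positive derivative inside.
\<close>
lemma less_integral_by_derivative:
  fixes f g g' :: "real \<Rightarrow> real"
  assumes "x > 0" "f integrable_on {0..x}" "continuous_on {0<..} f"
    and "continuous_on {0..x} g" "g 0 = 0"
    and "\<And>t. 0 < t \<Longrightarrow> t < x \<Longrightarrow> (g has_real_derivative g' t) (at t)"
    and "\<And>t. 0 < t \<Longrightarrow> t < x \<Longrightarrow> g' t < f t"
  shows "g x < integral {0..x} f"
proof -
  let ?d = "\<lambda>u. integral {0..u} f - g u"
  have "?d 0 < ?d x"
  proof (rule DERIV_pos_imp_increasing_open[where f = ?d and a = 0 and b = x])
    fix t assume t: "0 < t" "t < x"
    show "\<exists>y. (?d has_real_derivative y) (at t) \<and> y > 0"
      using DERIV_diff[OF integral_from_0_has_derivative[OF assms(2,3) t] assms(6)[OF t]]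
        assms(7)[OF t] by (intro exI[of _ "f t - g' t"]) auto
    next
    show "continuous_on {0..x} ?d"
      using assms by (intro continuous_intros indefinite_integral_continuous_1)
  qed (use assms in auto)
  thus ?thesis using assms(5) by simp
qed

lemma integral_less_by_derivative:
  fixes f g g' :: "real \<Rightarrow> real"
  assumes "x > 0" "f integrable_on {0..x}" "continuous_on {0<..} f"
    and "continuous_on {0..x} g" "g 0 = 0"
    and "\<And>t. 0 < t \<Longrightarrow> t < x \<Longrightarrow> (g has_real_derivative g' t) (at t)"
    and "\<And>t. 0 < t \<Longrightarrow> t < x \<Longrightarrow> f t < g' t"
  shows "integral {0..x} f < g x"
proof -
  have "- g x < integral {0..x} (\<lambda>t. - f t)"
    by (rule less_integral_by_derivative[where g' = "\<lambda>t. - g' t"])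
      (use assms in \<open>auto intro!: continuous_intros DERIV_minus integrable_neg\<close>)
  thus ?thesis by simp
qed

section \<open>The integral inequalities\<close>

text \<open>
  The derivative of the left-hand side is the integrand minus
  \<open>((\<mu>+1-a)/t + \<gamma>)\<close> times a positive function. The case \<open>a = \<mu> + 1\<close>, in which only the damping
  makes the inequality strict, is needed for the integrand \<open>exp (-\<gamma> t) t\<^bsup>\<nu>+1\<^esup> I\<^sub>\<nu>\<close>.
\<close>
lemma weighted_bessel_less_integral:
  assumes "\<gamma> > 0" "\<mu> > -1" "a + \<mu> + 1 > 0" "a \<le> \<mu> + 1" "x > 0"
  shows "weighted_bessel \<gamma> a (\<mu> + 1) x < integral {0..x} (weighted_bessel \<gamma> a \<mu>)"
proof (rule less_integral_by_derivative)
  fix t assume t: "0 < t" "t < x"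
  show "(weighted_bessel \<gamma> a (\<mu> + 1) has_real_derivative
      weighted_bessel \<gamma> a \<mu> t - ((\<mu> + 1 - a) / t + \<gamma>) * weighted_bessel \<gamma> a (\<mu> + 1) t) (at t)"
    using assms t by (intro weighted_bessel_deriv) auto
  have "(\<mu> + 1 - a) / t + \<gamma> > 0"
    using assms t by (intro add_nonneg_pos divide_nonneg_pos) auto
  thus "weighted_bessel \<gamma> a \<mu> t - ((\<mu> + 1 - a) / t + \<gamma>) * weighted_bessel \<gamma> a (\<mu> + 1) t
      < weighted_bessel \<gamma> a \<mu> t"
    using assms t by (simp add: weighted_bessel_pos)
qed (use assms in \<open>auto intro!: integrable_weighted_bessel continuous_on_weighted_bessel\<close>)

text \<open>
  Write \<open>s = a + \<mu> + 1\<close> and \<open>k = \<mu> + 1 - a\<close>, so that \<open>2(\<mu>+1) - k = s\<close>. Differentiating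
  \<open>2(\<mu>+1) t\<^sup>a I\<^bsub>\<mu>+1\<^esub>\<close> gives \<open>t\<^sup>a (2(\<mu>+1) I\<^sub>\<mu> - k (I\<^sub>\<mu> - I\<^bsub>\<mu>+2\<^esub>))\<close> by the recurrence, that is,
  \<open>t\<^sup>a (s I\<^sub>\<mu> + k I\<^bsub>\<mu>+2\<^esub>)\<close>. The correction \<open>- k t\<^sup>a I\<^bsub>\<mu>+3\<^esub>\<close> is chosen to cancel \<open>k I\<^bsub>\<mu>+2\<^esub>\<close>; its own
  derivative leaves the positive remainder \<open>k (k+2) t\<^bsup>a-1\<^esup> I\<^bsub>\<mu>+3\<^esub>\<close>.
\<close>
lemma integral_weighted_bessel_less:
  assumes "\<mu> > -1" "a + \<mu> + 1 > 0" "a < \<mu> + 1" "x > 0"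
  shows "integral {0..x} (weighted_bessel 0 a \<mu>) < 1 / (a + \<mu> + 1) *
    (2 * (\<mu> + 1) * weighted_bessel 0 a (\<mu> + 1) x
      - (\<mu> + 1 - a) * weighted_bessel 0 a (\<mu> + 3) x)" (is "_ < ?g x")
proof (rule integral_less_by_derivative[where g = ?g])
  let ?w = "weighted_bessel 0 a"
  fix t assume t: "0 < t" "t < x"
  let ?g' = "1 / (a + \<mu> + 1) *
    (2 * (\<mu> + 1) * (?w \<mu> t - (\<mu> + 1 - a) / t * ?w (\<mu> + 1) t)
      - (\<mu> + 1 - a) * (?w (\<mu> + 2) t - (\<mu> + 3 - a) / t * ?w (\<mu> + 3) t))"
  show "(?g has_real_derivative ?g') (at t)"
    using assms t weighted_bessel_deriv[of \<mu> t 0 a] weighted_bessel_deriv[of "\<mu> + 2" t 0 a]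
    by (intro DERIV_cmult DERIV_diff) (simp_all add: add_ac)
  have "?g' = ?w \<mu> t + (\<mu> + 1 - a) * (\<mu> + 3 - a) / (t * (a + \<mu> + 1)) * ?w (\<mu> + 3) t"
  proof -
    have w: "?w (\<mu> + 2) t = ?w \<mu> t - 2 * (\<mu> + 1) / t * ?w (\<mu> + 1) t"
      using weighted_bessel_recurrence[of \<mu> t 0 a] assms t by simp
    have "2 * (\<mu> + 1) * (?w \<mu> t - (\<mu> + 1 - a) / t * ?w (\<mu> + 1) t)
        - (\<mu> + 1 - a) * (?w (\<mu> + 2) t - (\<mu> + 3 - a) / t * ?w (\<mu> + 3) t)
        = (a + \<mu> + 1) * ?w \<mu> t + (\<mu> + 1 - a) * (\<mu> + 3 - a) / t * ?w (\<mu> + 3) t"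
      unfolding w using t by (simp add: field_simps)
    moreover have "1 / s * (s * A + K / t * B) = A + K / (t * s) * B" if "s \<noteq> 0" for s A K B :: real
      using that t by (simp add: field_simps)
    ultimately show ?thesis using assms(2) by simp
  qed
  moreover have "(\<mu> + 1 - a) * (\<mu> + 3 - a) / (t * (a + \<mu> + 1)) * ?w (\<mu> + 3) t > 0"
    using assms t by (intro mult_pos_pos divide_pos_pos weighted_bessel_pos) auto
  ultimately show "?w \<mu> t < ?g'" by simp
qed (use assms in \<open>auto intro!: integrable_weighted_bessel continuous_intros continuous_on_weighted_bessel\<close>)

text \<open>
  Here \<open>(t\<^sup>\<nu> I\<^sub>\<nu>)' = t\<^sup>\<nu> I\<^bsub>\<nu>-1\<^esub>\<close>, which exceeds \<open>t\<^sup>\<nu> I\<^sub>\<nu>\<close> by Soni's inequality for the order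
  \<open>\<nu> - 1 \<ge> -1/2\<close>; this is the source of the hypothesis \<open>\<nu> \<ge> 1/2\<close>.
\<close>
lemma integral_weighted_bessel_less_integrand:
  assumes "\<nu> \<ge> 1/2" "x > 0"
  shows "integral {0..x} (weighted_bessel 0 \<nu> \<nu>) < weighted_bessel 0 \<nu> \<nu> x"
proof (rule integral_less_by_derivative)
  fix t assume t: "0 < t" "t < x"
  show "(weighted_bessel 0 \<nu> \<nu> has_real_derivative weighted_bessel 0 \<nu> (\<nu> - 1) t) (at t)"
    using weighted_bessel_deriv[of "\<nu> - 1" t 0 \<nu>] assms t by simp
  show "weighted_bessel 0 \<nu> \<nu> t < weighted_bessel 0 \<nu> (\<nu> - 1) t"
    using weighted_bessel_decreasing_in_order[of "\<nu> - 1" t 0 \<nu>] assms t by simp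
qed (use assms in \<open>auto intro!: integrable_weighted_bessel continuous_on_weighted_bessel\<close>)

text \<open>
  With \<open>w = t\<^sup>\<nu> I\<^sub>\<nu>\<close> and \<open>F\<close> its integral, \<open>(exp (-\<gamma> t) F)' = exp (-\<gamma> t) (w - \<gamma> F)\<close>, and \<open>F < w\<close> bounds
  this below by \<open>(1 - \<gamma>) exp (-\<gamma> t) w\<close>. Thus damping costs at most the factor \<open>1/(1-\<gamma>)\<close>, and bounds
  for the undamped integral carry over.
\<close>
lemma integral_damped_bessel_less:
  assumes "0 < \<gamma>" "\<gamma> < 1" "\<nu> \<ge> 1/2" "x > 0"
  shows "integral {0..x} (weighted_bessel \<gamma> \<nu> \<nu>)
    < exp (- \<gamma> * x) / (1 - \<gamma>) * integral {0..x} (weighted_bessel 0 \<nu> \<nu>)"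
proof (rule integral_less_by_derivative[where
    g = "\<lambda>x. exp (- \<gamma> * x) / (1 - \<gamma>) * integral {0..x} (weighted_bessel 0 \<nu> \<nu>)"])
  let ?w = "weighted_bessel 0 \<nu> \<nu>"
  let ?F = "\<lambda>t. integral {0..t} ?w"
  have int: "?w integrable_on {0..x}"
    using assms by (intro integrable_weighted_bessel) auto
  have cont: "continuous_on {0<..} ?w"
    using assms by (intro continuous_on_weighted_bessel) auto
  show "continuous_on {0..x} (\<lambda>x. exp (- \<gamma> * x) / (1 - \<gamma>) * ?F x)"
    using int assms by (intro continuous_intros indefinite_integral_continuous_1) auto
  fix t assume t: "0 < t" "t < x"
  show "((\<lambda>x. exp (- \<gamma> * x) / (1 - \<gamma>) * ?F x) has_real_derivative
      exp (- \<gamma> * t) / (1 - \<gamma>) * (?w t - \<gamma> * ?F t)) (at t)"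
  proof (rule DERIV_cong[OF DERIV_mult])
    show "((\<lambda>x. exp (- \<gamma> * x) / (1 - \<gamma>)) has_real_derivative
        - \<gamma> * (exp (- \<gamma> * t) / (1 - \<gamma>))) (at t)"
      using assms(2) by (auto intro!: derivative_eq_intros)
    show "(?F has_real_derivative ?w t) (at t)"
      by (rule integral_from_0_has_derivative[OF int cont t])
  qed (simp add: right_diff_distrib mult_ac)
  have "\<gamma> * ?F t < \<gamma> * ?w t"
    using integral_weighted_bessel_less_integrand[of \<nu> t] assms t by simp
  hence "exp (- \<gamma> * t) / (1 - \<gamma>) * ((1 - \<gamma>) * ?w t)
      < exp (- \<gamma> * t) / (1 - \<gamma>) * (?w t - \<gamma> * ?F t)"
    using assms by (intro mult_strict_left_mono) (auto simp: algebra_simps)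
  thus "weighted_bessel \<gamma> \<nu> \<nu> t < exp (- \<gamma> * t) / (1 - \<gamma>) * (?w t - \<gamma> * ?F t)"
    using assms by (simp add: weighted_bessel_damping[of \<gamma>])
qed (use assms in \<open>auto intro!: integrable_weighted_bessel continuous_on_weighted_bessel\<close>)

text \<open>
  The power \<open>\<nu> + 1\<close> matches the order, so the derivative of the bound has only the damping term
  \<open>\<gamma> I\<^bsub>\<nu>+1\<^esub>\<close> besides \<open>I\<^sub>\<nu>\<close>, and Soni's inequality applies.
\<close>
lemma integral_bessel_next_power_less:
  assumes "0 < \<gamma>" "\<gamma> < 1" "\<nu> > -1/2" "x > 0"
  shows "integral {0..x} (weighted_bessel \<gamma> (\<nu> + 1) \<nu>)
    < 1 / (1 - \<gamma>) * weighted_bessel \<gamma> (\<nu> + 1) (\<nu> + 1) x"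
proof (rule integral_less_by_derivative[where
    g = "\<lambda>x. 1 / (1 - \<gamma>) * weighted_bessel \<gamma> (\<nu> + 1) (\<nu> + 1) x"])
  let ?w = "weighted_bessel \<gamma> (\<nu> + 1)"
  fix t assume t: "0 < t" "t < x"
  show "((\<lambda>x. 1 / (1 - \<gamma>) * ?w (\<nu> + 1) x) has_real_derivative
      1 / (1 - \<gamma>) * (?w \<nu> t - \<gamma> * ?w (\<nu> + 1) t)) (at t)"
    using weighted_bessel_deriv[of \<nu> t \<gamma> "\<nu> + 1"] assms t by (intro DERIV_cmult) auto
  have "\<gamma> * ?w (\<nu> + 1) t < \<gamma> * ?w \<nu> t"
    using weighted_bessel_decreasing_in_order[of \<nu> t] assms t by simp
  thus "?w \<nu> t < 1 / (1 - \<gamma>) * (?w \<nu> t - \<gamma> * ?w (\<nu> + 1) t)"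
    using assms by (simp add: field_simps)
qed (use assms in \<open>auto intro!: integrable_weighted_bessel continuous_intros continuous_on_weighted_bessel\<close>)

section \<open>Optimality of the constants\<close>

text \<open>
  Keeping only the leading term \<open>2\<^bsup>-\<mu>\<^esup> rGamma (\<mu>+1) t\<^bsup>a+\<mu>\<^esup>\<close> of the integrand bounds the integral from
  below by a multiple of \<open>x\<^sup>s\<close> with \<open>s = a + \<mu> + 1\<close>, which is also the leading power of the upper
  bound. Dividing by \<open>x\<^sup>s\<close> and letting \<open>x \<rightarrow> 0\<close> compares the two leading coefficients.
\<close>
lemma undamped_upper_constant_optimal:
  assumes "\<mu> > -1" "a + \<mu> + 1 > 0"
    and bound: "\<And>x. x > 0 \<Longrightarrow>
      integral {0..x} (weighted_bessel 0 a \<mu>) < C * weighted_bessel 0 a (\<mu> + 1) x"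
  shows "2 * (\<mu> + 1) / (a + \<mu> + 1) \<le> C"
proof -
  define s where "s = a + \<mu> + 1"
  define r where "r = rGamma (\<mu> + 2)"
  have s: "s > 0" using assms by (simp add: s_def)
  have r: "r > 0" using bessel_clifford_pos[of "\<mu> + 1" 0] assms
    by (simp add: r_def bessel_clifford_0 add_ac)
  have rec: "rGamma (\<mu> + 1) = (\<mu> + 1) * r"
    using rGamma_plus1[of "\<mu> + 1"] by (simp add: r_def add_ac)
  let ?c = "2 powr (-\<mu>) * ((\<mu> + 1) * r)"
  have le: "2 * (\<mu> + 1) * r / s \<le> C * bessel_clifford (\<mu> + 1) (x^2 / 4)" if x: "x > 0" for x
  proof -
    have "?c / s * x powr s < integral {0..x} (weighted_bessel 0 a \<mu>)"
    proof (rule less_integral_by_derivative[where g = "\<lambda>x. ?c / s * x powr s"])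
      fix t assume t: "0 < t" "t < x"
      show "((\<lambda>x. ?c / s * x powr s) has_real_derivative ?c * t powr (a + \<mu>)) (at t)"
        using DERIV_cmult[OF has_real_derivative_powr[OF t(1), of s], of "?c / s"] s
        by (simp add: s_def mult.assoc)
      show "?c * t powr (a + \<mu>) < weighted_bessel 0 a \<mu> t"
        using assms t bessel_clifford_gt_value_at_0[of \<mu> "t^2 / 4"]
        by (simp add: weighted_bessel_eq_clifford rec)
    qed (use assms x s in \<open>auto intro!: integrable_weighted_bessel continuous_on_weighted_bessel
        continuous_intros continuous_on_powr'\<close>)
    also have "\<dots> < C * weighted_bessel 0 a (\<mu> + 1) x" by (rule bound[OF x])
    also have "C * weighted_bessel 0 a (\<mu> + 1) x
        = (2 powr (-\<mu>) / 2 * x powr s) * (C * bessel_clifford (\<mu> + 1) (x^2 / 4))"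
    proof -
      have "2 powr (- \<mu> - 1) = 2 powr (- \<mu>) / 2" and "s = a + (\<mu> + 1)"
        using powr_diff[of 2 "- \<mu>" 1] by (simp_all add: s_def)
      thus ?thesis
        using weighted_bessel_eq_clifford[of "\<mu> + 1" x 0 a] assms(1) x by simp
    qed
    also have "?c / s * x powr s = (2 powr (-\<mu>) / 2 * x powr s) * (2 * (\<mu> + 1) * r / s)"
      using s by (simp add: field_simps)
    finally have "2 * (\<mu> + 1) * r / s < C * bessel_clifford (\<mu> + 1) (x^2 / 4)"
      by (rule mult_left_less_imp_less) simp
    thus ?thesis by simp
  qed
  have "((\<lambda>x. C * bessel_clifford (\<mu> + 1) (x^2 / 4)) \<longlongrightarrow> C * bessel_clifford (\<mu> + 1) (0^2 / 4))
      (at_right 0)"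
  proof -
    have "continuous_on UNIV (\<lambda>x. C * bessel_clifford (\<mu> + 1) (x^2 / 4))"
      using assms by (intro continuous_intros) auto
    hence "isCont (\<lambda>x. C * bessel_clifford (\<mu> + 1) (x^2 / 4)) 0"
      by (simp add: continuous_on_eq_continuous_at)
    thus ?thesis by (simp add: isCont_def filterlim_at_split)
  qed
  hence "2 * (\<mu> + 1) * r / s \<le> C * bessel_clifford (\<mu> + 1) (0^2 / 4)"
    by (rule tendsto_lowerbound)
      (use le eventually_at_right_less[of 0] in \<open>auto elim!: eventually_mono\<close>)
  also have "bessel_clifford (\<mu> + 1) (0^2 / 4) = r"
    by (simp add: bessel_clifford_0 r_def add_ac)
  finally have "(2 * (\<mu> + 1) / s) * r \<le> C * r" by simp
  hence "2 * (\<mu> + 1) / s \<le> C" using r by (rule mult_right_le_imp_le)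
  thus ?thesis by (simp add: s_def)
qed

text \<open>
  Without damping the integral equals \<open>x\<^bsup>\<nu>+1\<^esup> I\<^bsub>\<nu>+1\<^esub>(x)\<close>, and damping decreases it. The assumed bound
  thus forces \<open>C exp (-\<gamma> x) \<le> 1\<close> for all \<open>x > 0\<close>, and \<open>x \<rightarrow> 0\<close> gives the claim.
\<close>
lemma damped_lower_constant_optimal:
  assumes "\<gamma> > 0" "\<nu> > -1"
    and bound: "\<And>x. x > 0 \<Longrightarrow> C * weighted_bessel \<gamma> (\<nu> + 1) (\<nu> + 1) x
      < integral {0..x} (weighted_bessel \<gamma> (\<nu> + 1) \<nu>)"
  shows "C \<le> 1"
proof -
  have le: "C * exp (- \<gamma> * x) \<le> 1" if x: "x > 0" for x
  proof -
    have "integral {0..x} (weighted_bessel \<gamma> (\<nu> + 1) \<nu>)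
        < weighted_bessel 0 (\<nu> + 1) (\<nu> + 1) x"
    proof (rule integral_less_by_derivative)
      fix t assume t: "0 < t" "t < x"
      show "(weighted_bessel 0 (\<nu> + 1) (\<nu> + 1) has_real_derivative
          weighted_bessel 0 (\<nu> + 1) \<nu> t) (at t)"
        using weighted_bessel_deriv[of \<nu> t 0 "\<nu> + 1"] assms t by simp
      show "weighted_bessel \<gamma> (\<nu> + 1) \<nu> t < weighted_bessel 0 (\<nu> + 1) \<nu> t"
        using assms t weighted_bessel_pos[of \<nu> t 0 "\<nu> + 1"]
        by (simp add: weighted_bessel_damping[of \<gamma>])
    qed (use assms x in \<open>auto intro!: integrable_weighted_bessel continuous_on_weighted_bessel\<close>)
    with bound[OF x] have "C * exp (- \<gamma> * x) * weighted_bessel 0 (\<nu> + 1) (\<nu> + 1) x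
        < 1 * weighted_bessel 0 (\<nu> + 1) (\<nu> + 1) x"
      by (simp add: weighted_bessel_damping[of \<gamma>])
    moreover have "weighted_bessel 0 (\<nu> + 1) (\<nu> + 1) x > 0"
      using assms x by (intro weighted_bessel_pos) auto
    ultimately show ?thesis by (subst (asm) mult_less_cancel_right_pos) auto
  qed
  have "((\<lambda>x. C * exp (- \<gamma> * x)) \<longlongrightarrow> C * exp (- \<gamma> * 0)) (at_right 0)"
    by (intro tendsto_intros)
  hence "C * exp (- \<gamma> * 0) \<le> 1"
    by (rule tendsto_upperbound)
      (use le eventually_at_right_less[of 0] in \<open>auto elim!: eventually_mono\<close>)
  thus ?thesis by simp
qed

text \<open>
  A reverse of Soni's inequality, with a factor that tends to \<open>1\<close> as \<open>T \<rightarrow> \<infinity>\<close>: replace \<open>I\<^bsub>\<nu>+2\<^esub>\<close> by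
  the larger \<open>I\<^bsub>\<nu>+1\<^esub>\<close> in the recurrence.
\<close>
lemma weighted_bessel_le_next_order:
  assumes "\<nu> > -1" "T > 0" "t \<ge> T"
  shows "weighted_bessel \<gamma> a \<nu> t \<le> (1 + 2 * (\<nu> + 1) / T) * weighted_bessel \<gamma> a (\<nu> + 1) t"
proof -
  let ?w = "weighted_bessel \<gamma> a"
  have "?w \<nu> t = ?w (\<nu> + 2) t + 2 * (\<nu> + 1) / t * ?w (\<nu> + 1) t"
    using weighted_bessel_recurrence[of \<nu> t \<gamma> a] assms by simp
  also have "?w (\<nu> + 2) t \<le> ?w (\<nu> + 1) t"
    using weighted_bessel_decreasing_in_order[of "\<nu> + 1" t \<gamma> a] assms by (simp add: add_ac)
  also have "2 * (\<nu> + 1) / t * ?w (\<nu> + 1) t \<le> 2 * (\<nu> + 1) / T * ?w (\<nu> + 1) t"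
    using assms weighted_bessel_pos[of "\<nu> + 1" t \<gamma> a]
    by (intro mult_right_mono divide_left_mono mult_pos_pos) auto
  finally show ?thesis by (simp add: algebra_simps)
qed

text \<open>
  By Soni's inequality \<open>exp (-t) t\<^bsup>\<nu>+1\<^esup> I\<^bsub>\<nu>+1\<^esub>\<close> is increasing, its derivative being
  \<open>exp (-t) t\<^bsup>\<nu>+1\<^esup> (I\<^sub>\<nu> - I\<^bsub>\<nu>+1\<^esub>)\<close>.
\<close>
lemma weighted_bessel_exponential_growth:
  assumes "\<nu> \<ge> -1/2" "0 < T" "T \<le> x"
  shows "exp ((1 - \<gamma>) * (x - T)) * weighted_bessel \<gamma> (\<nu> + 1) (\<nu> + 1) T
    \<le> weighted_bessel \<gamma> (\<nu> + 1) (\<nu> + 1) x"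
proof -
  let ?w = "weighted_bessel 1 (\<nu> + 1)"
  have "?w (\<nu> + 1) T \<le> ?w (\<nu> + 1) x"
  proof (rule DERIV_nonneg_imp_nondecreasing[where f = "?w (\<nu> + 1)"])
    fix t assume t: "T \<le> t" "t \<le> x"
    show "\<exists>y. (?w (\<nu> + 1) has_real_derivative y) (at t) \<and> 0 \<le> y"
      using weighted_bessel_deriv[of \<nu> t 1 "\<nu> + 1"]
        weighted_bessel_decreasing_in_order[of \<nu> t 1 "\<nu> + 1"] assms t
      by (intro exI[of _ "?w \<nu> t - ?w (\<nu> + 1) t"]) auto
  qed (use assms in auto)
  hence "exp ((1 - \<gamma>) * x) * ?w (\<nu> + 1) T \<le> exp ((1 - \<gamma>) * x) * ?w (\<nu> + 1) x" by simp
  moreover have "weighted_bessel \<gamma> (\<nu> + 1) (\<nu> + 1) t = exp ((1 - \<gamma>) * t) * ?w (\<nu> + 1) t" for t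
  proof -
    have "exp (- \<gamma> * t) = exp ((1 - \<gamma>) * t) * exp (- 1 * t)"
      unfolding exp_add[symmetric] by (simp add: algebra_simps)
    thus ?thesis by (simp add: weighted_bessel_def)
  qed
  moreover have "exp ((1 - \<gamma>) * (x - T)) * exp ((1 - \<gamma>) * T) = exp ((1 - \<gamma>) * x)"
    unfolding exp_add[symmetric] by (simp add: algebra_simps)
  ultimately show ?thesis by (simp add: mult.assoc[symmetric])
qed

text \<open>
  Let \<open>f\<close> be the integrand, \<open>F\<close> its integral and \<open>h\<close> the function on the right, so that
  \<open>h' = f - \<gamma> h\<close>. For \<open>t \<ge> T\<close> the reverse of Soni's inequality gives \<open>h' \<le> k T f\<close> with
  \<open>k T \<rightarrow> 1 - \<gamma>\<close> as \<open>T \<rightarrow> \<infinity>\<close>; hence \<open>h x - h T \<le> k T (F x - F T) \<le> C (k T) h x\<close>. If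
  \<open>C (1 - \<gamma>) < 1\<close>, some \<open>T\<close> has \<open>C (k T) < 1\<close>, and then \<open>h\<close> would be bounded, against its
  exponential growth.
\<close>
lemma damped_upper_constant_optimal:
  assumes "0 < \<gamma>" "\<gamma> < 1" "\<nu> > -1/2"
    and bound: "\<And>x. x > 0 \<Longrightarrow> integral {0..x} (weighted_bessel \<gamma> (\<nu> + 1) \<nu>)
      < C * weighted_bessel \<gamma> (\<nu> + 1) (\<nu> + 1) x"
  shows "1 / (1 - \<gamma>) \<le> C"
proof (rule ccontr)
  let ?f = "weighted_bessel \<gamma> (\<nu> + 1) \<nu>" and ?h = "weighted_bessel \<gamma> (\<nu> + 1) (\<nu> + 1)"
  let ?F = "\<lambda>x. integral {0..x} ?f"
  assume "\<not> 1 / (1 - \<gamma>) \<le> C"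
  hence C: "C * (1 - \<gamma>) < 1" using assms by (simp add: field_simps)
  define k where "k = (\<lambda>T. 1 - \<gamma> / (1 + 2 * (\<nu> + 1) / T))"
  have "((\<lambda>T. C * (1 - \<gamma> / (1 + 2 * (\<nu> + 1) / T))) \<longlongrightarrow> C * (1 - \<gamma> / (1 + 0))) at_top"
    by (intro tendsto_intros real_tendsto_divide_at_top filterlim_ident) auto
  hence "\<forall>\<^sub>F T in at_top. C * k T < 1"
    using C by (auto simp: k_def intro!: order_tendstoD)
  then obtain T where T: "T > 0" "C * k T < 1"
    using eventually_conj[OF eventually_gt_at_top[of 0], of "\<lambda>T. C * k T < 1"]
    by (auto simp: eventually_at_top_linorder)
  have k0: "k T > 0"
  proof -
    define z where "z = 2 * (\<nu> + 1) / T"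
    have "z > 0" using assms(3) T by (simp add: z_def)
    moreover from this have "\<gamma> < 1 + z" using assms(2) by linarith
    ultimately show ?thesis
      unfolding k_def z_def[symmetric] by (simp add: pos_divide_less_eq)
  qed
  have hT: "?h T > 0" using assms T by (intro weighted_bessel_pos) auto
  have upper: "(1 - C * k T) * ?h x \<le> ?h T" if x: "x > T" for x
  proof -
    let ?d = "\<lambda>u. k T * ?F u - ?h u"
    have int: "?f integrable_on {0..x + 1}"
      using assms T x by (intro integrable_weighted_bessel) auto
    have cont: "continuous_on {0<..} ?f"
      using assms by (intro continuous_on_weighted_bessel) auto
    have "?d T \<le> ?d x"
    proof (rule DERIV_nonneg_imp_nondecreasing[where f = ?d and a = T and b = x])
      fix t assume t: "T \<le> t" "t \<le> x"
      have D: "(?d has_real_derivative k T * ?f t - (?f t - \<gamma> * ?h t)) (at t)"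
        using weighted_bessel_deriv[of \<nu> t \<gamma> "\<nu> + 1"] assms T t
        by (intro DERIV_diff DERIV_cmult integral_from_0_has_derivative[OF int cont]) auto
      have p: "1 + 2 * (\<nu> + 1) / T > 0"
        using assms T by (simp add: add_pos_pos)
      have "?f t \<le> (1 + 2 * (\<nu> + 1) / T) * ?h t"
        using assms T t by (intro weighted_bessel_le_next_order) auto
      hence "?f t / (1 + 2 * (\<nu> + 1) / T) \<le> ?h t"
        using p by (simp add: pos_divide_le_eq mult.commute)
      hence "\<gamma> * (?f t / (1 + 2 * (\<nu> + 1) / T)) \<le> \<gamma> * ?h t"
        using assms(1) by (intro mult_left_mono) auto
      hence "0 \<le> k T * ?f t - (?f t - \<gamma> * ?h t)"
        by (simp add: k_def left_diff_distrib)
      with D show "\<exists>y. (?d has_real_derivative y) (at t) \<and> 0 \<le> y" by blast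
    qed (use x in auto)
    moreover have "?F T \<ge> 0"
    proof (rule integral_nonneg)
      show "?f integrable_on {0..T}"
        using assms(3) T by (intro integrable_weighted_bessel) auto
      show "0 \<le> ?f t" if "t \<in> {0..T}" for t
        using weighted_bessel_pos[of \<nu> t \<gamma> "\<nu> + 1"] assms(3) that by (cases "t = 0") auto
    qed
    hence "k T * ?F T \<ge> 0" using k0 by simp
    moreover have "k T * ?F x \<le> k T * (C * ?h x)"
      using bound[of x] k0 T(1) x by (intro mult_left_mono) auto
    ultimately show ?thesis by (simp add: algebra_simps)
  qed
  define q where "q = 1 - C * k T"
  have q: "q > 0" using T by (simp add: q_def)
  \<comment> \<open>At this point \<open>exp ((1 - \<gamma>) (x - T)) > 1 / q\<close>, by \<open>exp u \<ge> 1 + u\<close> with \<open>u = 1 / q\<close>.\<close>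
  define x where "x = T + 1 / ((1 - \<gamma>) * q)"
  have x: "x > T" using q assms by (simp add: x_def)
  have "1 < q * (1 + (1 - \<gamma>) * (x - T))"
    using q assms by (simp add: x_def field_simps)
  also have "\<dots> \<le> q * exp ((1 - \<gamma>) * (x - T))"
    using q by (intro mult_left_mono exp_ge_add_one_self) auto
  finally have "1 * ?h T < q * exp ((1 - \<gamma>) * (x - T)) * ?h T"
    using hT by (rule mult_strict_right_mono)
  also have "\<dots> \<le> q * ?h x"
    using weighted_bessel_exponential_growth[of \<nu> T x \<gamma>] q assms T x
    by (simp add: mult.assoc)
  also have "\<dots> \<le> ?h T" using upper[OF x] by (simp add: q_def)
  finally show False by simp
qed

section \<open>The inequalities and their optimality\<close>

theorem theorem2p3:
  fixes \<gamma> n :: real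
  assumes "0 < \<gamma>" and "\<gamma> < 1" and "n > -1"
  shows
    "(\<forall>\<nu> > - (1/2) * (n + 1). \<forall>x > 0.
        integral {0..x} (\<lambda>t. exp (- \<gamma> * t) * t powr \<nu> * bessel_I (\<nu> + n) t)
          > exp (- \<gamma> * x) * x powr \<nu> * bessel_I (\<nu> + n + 1) x)
   \<and> (\<forall>\<nu> > - (1/2) * (n + 1). \<forall>x > 0.
        integral {0..x} (\<lambda>t. t powr \<nu> * bessel_I (\<nu> + n) t)
          < x powr \<nu> / (2 * \<nu> + n + 1) *
            (2 * (\<nu> + n + 1) * bessel_I (\<nu> + n + 1) x - (n + 1) * bessel_I (\<nu> + n + 3) x))
   \<and> (\<forall>\<nu> > - (1/2) * (n + 1). \<forall>x > 0.
        x powr \<nu> / (2 * \<nu> + n + 1) *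
            (2 * (\<nu> + n + 1) * bessel_I (\<nu> + n + 1) x - (n + 1) * bessel_I (\<nu> + n + 3) x)
          < 2 * (\<nu> + n + 1) / (2 * \<nu> + n + 1) * (x powr \<nu> * bessel_I (\<nu> + n + 1) x))
   \<and> (\<forall>\<nu> \<ge> 1/2. \<forall>x > 0.
        integral {0..x} (\<lambda>t. exp (- \<gamma> * t) * t powr \<nu> * bessel_I \<nu> t)
          < exp (- \<gamma> * x) * x powr \<nu> / ((2 * \<nu> + 1) * (1 - \<gamma>)) *
            (2 * (\<nu> + 1) * bessel_I (\<nu> + 1) x - bessel_I (\<nu> + 3) x))
   \<and> (\<forall>\<nu> > -1. \<forall>x > 0.
        integral {0..x} (\<lambda>t. exp (- \<gamma> * t) * t powr (\<nu> + 1) * bessel_I \<nu> t)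
          > exp (- \<gamma> * x) * x powr (\<nu> + 1) * bessel_I (\<nu> + 1) x)
   \<and> (\<forall>\<nu> > - 1/2. \<forall>x > 0.
        integral {0..x} (\<lambda>t. exp (- \<gamma> * t) * t powr (\<nu> + 1) * bessel_I \<nu> t)
          < 1 / (1 - \<gamma>) * (exp (- \<gamma> * x) * x powr (\<nu> + 1) * bessel_I (\<nu> + 1) x))
   \<and> (\<forall>\<nu> > - (1/2) * (n + 1). \<forall>C < 2 * (\<nu> + n + 1) / (2 * \<nu> + n + 1).
        \<not> (\<forall>x > 0. integral {0..x} (\<lambda>t. t powr \<nu> * bessel_I (\<nu> + n) t)
                    < C * (x powr \<nu> * bessel_I (\<nu> + n + 1) x)))
   \<and> (\<forall>\<nu> > -1. \<forall>C > 1.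
        \<not> (\<forall>x > 0. integral {0..x} (\<lambda>t. exp (- \<gamma> * t) * t powr (\<nu> + 1) * bessel_I \<nu> t)
                    > C * (exp (- \<gamma> * x) * x powr (\<nu> + 1) * bessel_I (\<nu> + 1) x)))
   \<and> (\<forall>\<nu> > - 1/2. \<forall>C < 1 / (1 - \<gamma>).
        \<not> (\<forall>x > 0. integral {0..x} (\<lambda>t. exp (- \<gamma> * t) * t powr (\<nu> + 1) * bessel_I \<nu> t)
                    < C * (exp (- \<gamma> * x) * x powr (\<nu> + 1) * bessel_I (\<nu> + 1) x)))
   \<and> (\<forall>\<gamma>' > 0.
        (\<forall>\<nu> > - (1/2) * (n + 1). \<forall>x > 0.
           integral {0..x} (\<lambda>t. exp (- \<gamma>' * t) * t powr \<nu> * bessel_I (\<nu> + n) t)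
             > exp (- \<gamma>' * x) * x powr \<nu> * bessel_I (\<nu> + n + 1) x)
      \<and> (\<forall>\<nu> > -1. \<forall>x > 0.
           integral {0..x} (\<lambda>t. exp (- \<gamma>' * t) * t powr (\<nu> + 1) * bessel_I \<nu> t)
             > exp (- \<gamma>' * x) * x powr (\<nu> + 1) * bessel_I (\<nu> + 1) x))"
  (is "?c1 \<and> ?c2 \<and> ?c3 \<and> ?c4 \<and> ?c5 \<and> ?c6 \<and> ?c7 \<and> ?c8 \<and> ?c9 \<and> ?c10")
proof -
  have damped: "(\<lambda>t. exp (- \<gamma> * t) * t powr a * bessel_I \<mu> t) = weighted_bessel \<gamma> a \<mu>"
    and damped_at: "exp (- \<gamma> * x) * x powr a * bessel_I \<mu> x = weighted_bessel \<gamma> a \<mu> x"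
    and undamped: "(\<lambda>t. t powr a * bessel_I \<mu> t) = weighted_bessel 0 a \<mu>"
    and undamped_at: "x powr a * bessel_I \<mu> x = weighted_bessel 0 a \<mu> x" for \<gamma> a \<mu> x
    by (auto simp: weighted_bessel_def)

  have lower: "exp (- \<gamma>' * x) * x powr \<nu> * bessel_I (\<nu> + n + 1) x
      < integral {0..x} (\<lambda>t. exp (- \<gamma>' * t) * t powr \<nu> * bessel_I (\<nu> + n) t)"
    if "\<gamma>' > 0" "\<nu> > - (1/2) * (n + 1)" "x > 0" for \<gamma>' \<nu> x
    unfolding damped damped_at
    using that assms by (intro weighted_bessel_less_integral) (auto simp: field_simps)
  have lower_next: "exp (- \<gamma>' * x) * x powr (\<nu> + 1) * bessel_I (\<nu> + 1) x
      < integral {0..x} (\<lambda>t. exp (- \<gamma>' * t) * t powr (\<nu> + 1) * bessel_I \<nu> t)"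
    if "\<gamma>' > 0" "\<nu> > -1" "x > 0" for \<gamma>' \<nu> x
    unfolding damped damped_at
    using that by (intro weighted_bessel_less_integral) auto
  have upper: "integral {0..x} (weighted_bessel 0 \<nu> (\<nu> + m))
      < x powr \<nu> / (2 * \<nu> + m + 1) *
        (2 * (\<nu> + m + 1) * bessel_I (\<nu> + m + 1) x - (m + 1) * bessel_I (\<nu> + m + 3) x)"
    if "\<nu> > - (1/2) * (m + 1)" "m > -1" "x > 0" for \<nu> m x
  proof -
    have "integral {0..x} (weighted_bessel 0 \<nu> (\<nu> + m)) < 1 / (\<nu> + (\<nu> + m) + 1) *
      (2 * (\<nu> + m + 1) * weighted_bessel 0 \<nu> (\<nu> + m + 1) x
        - (\<nu> + m + 1 - \<nu>) * weighted_bessel 0 \<nu> (\<nu> + m + 3) x)"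
      using that by (intro integral_weighted_bessel_less) (auto simp: field_simps)
    also have "\<nu> + (\<nu> + m) + 1 = 2 * \<nu> + m + 1" by simp
    also have "\<nu> + m + 1 - \<nu> = m + 1" by simp
    finally show ?thesis
      by (simp add: undamped_at[where x = x, symmetric] diff_divide_distrib right_diff_distrib mult_ac)
  qed

  have ?c1 using lower[OF assms(1)] by blast
  moreover have ?c2 unfolding undamped using upper assms by blast
  moreover have ?c3
  proof (intro allI impI)
    fix \<nu> x :: real assume h: "\<nu> > - (1/2) * (n + 1)" "x > 0"
    let ?s = "2 * \<nu> + n + 1"
    have s: "?s > 0" using h by (simp add: field_simps)
    have "(n + 1) * bessel_I (\<nu> + n + 3) x > 0"
      using assms h by (intro mult_pos_pos bessel_I_pos) (auto simp: field_simps)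
    hence "x powr \<nu> / ?s * (2 * (\<nu> + n + 1) * bessel_I (\<nu> + n + 1) x - (n + 1) * bessel_I (\<nu> + n + 3) x)
        < x powr \<nu> / ?s * (2 * (\<nu> + n + 1) * bessel_I (\<nu> + n + 1) x)"
      using s h by (intro mult_strict_left_mono) auto
    thus "x powr \<nu> / ?s * (2 * (\<nu> + n + 1) * bessel_I (\<nu> + n + 1) x - (n + 1) * bessel_I (\<nu> + n + 3) x)
        < 2 * (\<nu> + n + 1) / ?s * (x powr \<nu> * bessel_I (\<nu> + n + 1) x)"
      by (simp only: times_divide_eq_left times_divide_eq_right mult_ac)
  qed
  moreover have ?c4
  proof (intro allI impI)
    fix \<nu> x :: real assume h: "\<nu> \<ge> 1/2" "x > 0"
    let ?G = "2 * (\<nu> + 1) * bessel_I (\<nu> + 1) x - bessel_I (\<nu> + 3) x"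
    have "integral {0..x} (weighted_bessel \<gamma> \<nu> \<nu>)
        < exp (- \<gamma> * x) / (1 - \<gamma>) * integral {0..x} (weighted_bessel 0 \<nu> \<nu>)"
      using assms h by (intro integral_damped_bessel_less) auto
    also have "\<dots> < exp (- \<gamma> * x) / (1 - \<gamma>) * (x powr \<nu> / (2 * \<nu> + 1) * ?G)"
      using upper[of 0 \<nu> x] assms h by (intro mult_strict_left_mono) auto
    also have "\<dots> = exp (- \<gamma> * x) * x powr \<nu> / ((2 * \<nu> + 1) * (1 - \<gamma>)) * ?G"
      by (simp only: times_divide_eq_left times_divide_eq_right divide_divide_eq_left mult_ac)
    finally show "integral {0..x} (\<lambda>t. exp (- \<gamma> * t) * t powr \<nu> * bessel_I \<nu> t)
        < exp (- \<gamma> * x) * x powr \<nu> / ((2 * \<nu> + 1) * (1 - \<gamma>)) * ?G"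
      unfolding damped .
  qed
  moreover have ?c5 using lower_next[OF assms(1)] by blast
  moreover have ?c6
    unfolding damped damped_at using integral_bessel_next_power_less[OF assms(1,2)] by simp
  moreover have ?c7
  proof (intro allI impI notI)
    fix \<nu> C assume h: "\<nu> > - (1/2) * (n + 1)" "C < 2 * (\<nu> + n + 1) / (2 * \<nu> + n + 1)"
      "\<forall>x>0. integral {0..x} (\<lambda>t. t powr \<nu> * bessel_I (\<nu> + n) t)
        < C * (x powr \<nu> * bessel_I (\<nu> + n + 1) x)"
    have "2 * (\<nu> + n + 1) / (\<nu> + (\<nu> + n) + 1) \<le> C"
      using h(1,3) assms unfolding undamped undamped_at
      by (intro undamped_upper_constant_optimal) (auto simp: field_simps)
    moreover have "\<nu> + (\<nu> + n) + 1 = 2 * \<nu> + n + 1" by simp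
    ultimately show False using h(2) by simp
  qed
  moreover have ?c8
  proof (intro allI impI notI)
    fix \<nu> C :: real assume h: "\<nu> > -1" "C > 1"
      "\<forall>x>0. C * (exp (- \<gamma> * x) * x powr (\<nu> + 1) * bessel_I (\<nu> + 1) x)
        < integral {0..x} (\<lambda>t. exp (- \<gamma> * t) * t powr (\<nu> + 1) * bessel_I \<nu> t)"
    have "C \<le> 1"
      by (rule damped_lower_constant_optimal[OF assms(1) h(1) h(3)[unfolded damped damped_at, rule_format]])
    thus False using h(2) by simp
  qed
  moreover have ?c9
  proof (intro allI impI notI)
    fix \<nu> C :: real assume h: "\<nu> > - 1/2" "C < 1 / (1 - \<gamma>)"
      "\<forall>x>0. integral {0..x} (\<lambda>t. exp (- \<gamma> * t) * t powr (\<nu> + 1) * bessel_I \<nu> t)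
        < C * (exp (- \<gamma> * x) * x powr (\<nu> + 1) * bessel_I (\<nu> + 1) x)"
    have "1 / (1 - \<gamma>) \<le> C"
      by (rule damped_upper_constant_optimal[OF assms(1,2) h(1) h(3)[unfolded damped damped_at, rule_format]])
    thus False using h(2) by simp
  qed
  moreover have ?c10 using lower lower_next by blast
  ultimately show ?thesis by (intro conjI)
qed

end
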